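(* Let $q\in\mathbb{R}\setminus\{0,1,-1\}$, let $n\ge 1$ be an integer, let $p(x)=\sum_{k\ge 0}a_kx^k$ be a nonzero polynomial with complex coefficients, and let $D$ be the difference operator acting on functions $f:\mathbb{R}\to\mathbb{C}$ by $$Df(h)=-p(1)\,f(0)+\sum_{k\ge 0}a_k f(q^kh).$$ Then $D$ has the Marcinkiewicz-Zygmund property of order $n$ if and only if $p(x)$ has no roots in the set $$\mathcal{A}_q := \begin{cases}\{z\in\mathbb{C} : |q|^{n-1}<|z|\le |q|^n\}, & \text{if } |q|>1,\\ \{z\in\mathbb{C} : |q|^{n}\le|z|< |q|^{n-1}\}, & \text{if } 0<|q|<1.\end{cases}$$
   Context: For a function $F:\mathbb{R}\to\mathbb{C}$ and an integer $m\ge 0$, $F(h)=o(h^m)$ means $\lim_{h\to 0}|F(h)|/|h|^m=0$ (limit over $h\neq 0$). The operator $D$ has the Marcinkiewicz-Zygmund (MZ) property of order $n$ if for all functions $f:\mathbb{R}\to\mathbb{C}$, the conditions $f(h)=o(h^{n-1})$ and $Df(h)=o(h^n)$ imply $f(h)=o(h^n)$. *)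

theory Defs
  imports
    "HOL-Analysis.Analysis"
    "HOL-Library.Landau_Symbols"
    "HOL-Computational_Algebra.Polynomial"
begin

text \<open>
  The filter \<open>at 0\<close> excludes \<open>h = 0\<close>, so neither hypothesis constrains \<open>f 0\<close> directly.
  The exponent \<open>n - 1\<close> is truncated; the property is only meant for \<open>n \<ge> 1\<close>.
\<close>
definition MZ_property :: "nat \<Rightarrow> ((real \<Rightarrow> complex) \<Rightarrow> (real \<Rightarrow> complex)) \<Rightarrow> bool" where
  "MZ_property n D \<longleftrightarrow>
     (\<forall>f. f \<in> o[at 0](\<lambda>h. of_real h ^ (n - 1)) \<longrightarrow> D f \<in> o[at 0](\<lambda>h. of_real h ^ n)
          \<longrightarrow> f \<in> o[at 0](\<lambda>h. of_real h ^ n))"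

text \<open>The Landau symbol used above is the usual limit condition.\<close>
lemma smallo_power_at_0_iff:
  fixes F :: "real \<Rightarrow> complex"
  shows "F \<in> o[at 0](\<lambda>h. of_real h ^ m) \<longleftrightarrow> ((\<lambda>h. norm (F h) / \<bar>h\<bar> ^ m) \<longlongrightarrow> 0) (at 0)"
proof -
  have nz: "eventually (\<lambda>h::real. (of_real h :: complex) ^ m \<noteq> 0) (at 0)"
    unfolding eventually_at_filter by (rule always_eventually) simp
  have "F \<in> o[at 0](\<lambda>h. of_real h ^ m) \<longleftrightarrow> ((\<lambda>h. F h / of_real h ^ m) \<longlongrightarrow> 0) (at 0)"
    using smalloI_tendsto[OF _ nz] smalloD_tendsto by blast
  also have "\<dots> \<longleftrightarrow> ((\<lambda>h. norm (F h / of_real h ^ m)) \<longlongrightarrow> 0) (at 0)"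
    by (simp add: tendsto_norm_zero_iff)
  finally show ?thesis by (simp add: norm_divide norm_power)
qed

definition diff_op :: "real \<Rightarrow> complex poly \<Rightarrow> (real \<Rightarrow> complex) \<Rightarrow> (real \<Rightarrow> complex)" where
  "diff_op q p f = (\<lambda>h. - poly p 1 * f 0 + (\<Sum>k\<le>degree p. coeff p k * f (q ^ k * h)))"

text \<open>Only meant for \<open>q\<close> with \<open>\<bar>q\<bar> \<notin> {0, 1}\<close>, so the second case is \<open>0 < \<bar>q\<bar> < 1\<close>.\<close>
definition annulus :: "real \<Rightarrow> nat \<Rightarrow> complex set" where
  "annulus q n =
     (if \<bar>q\<bar> > 1 then {z. \<bar>q\<bar> ^ (n - 1) < norm z \<and> norm z \<le> \<bar>q\<bar> ^ n}
      else {z. \<bar>q\<bar> ^ n \<le> norm z \<and> norm z < \<bar>q\<bar> ^ (n - 1)})"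

end

theory Submission
  imports Defs "HOL-Computational_Algebra.Fundamental_Theorem_Algebra"
begin

text \<open>
  Writing \<open>T f h = f (q * h)\<close>, the operator is \<open>p(T)\<close> up to the term \<open>p(1) f(0)\<close>, which vanishes
  under the hypotheses because \<open>f\<close> and \<open>D f\<close> tend to 0. A root \<open>z\<close> of \<open>p\<close> in the annulus gives the
  eigenfunction \<open>f h = \<bar>h\<bar> powr (Ln z / ln \<bar>q\<bar>)\<close> of \<open>T\<close>, which \<open>D\<close> annihilates and whose order of
  vanishing lies in \<open>{n-1<..n}\<close>. Conversely, factoring \<open>p\<close> into linear polynomials reduces the
  claim to the operators \<open>T - z\<close>. For these, with \<open>\<bar>q\<bar> > 1\<close>, one iterates the relation
  \<open>g (q * h) = z * g h + o(h ^ n)\<close> towards 0 if \<open>\<bar>z\<bar> \<le> \<bar>q\<bar> ^ (n - 1)\<close> and away from 0 if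
  \<open>\<bar>z\<bar> > \<bar>q\<bar> ^ n\<close>; in both cases the errors form a convergent geometric series. The case
  \<open>\<bar>q\<bar> < 1\<close> follows by passing to \<open>1 / q\<close> and \<open>1 / z\<close>.
\<close>

section \<open>Little-o at 0 with explicit bounds\<close>

lemma smallo_power_at_0_eps_delta:
  fixes F :: "real \<Rightarrow> complex"
  shows "F \<in> o[at 0](\<lambda>h. of_real h ^ m) \<longleftrightarrow>
    (\<forall>e>0. \<exists>d>0. \<forall>h. h \<noteq> 0 \<longrightarrow> \<bar>h\<bar> < d \<longrightarrow> norm (F h) \<le> e * \<bar>h\<bar> ^ m)"
  unfolding smallo_def eventually_at by (simp add: norm_power imp_conjL)

lemma smallo_power_at_0_rescale:
  fixes F :: "real \<Rightarrow> complex"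
  assumes F: "F \<in> o[at 0](\<lambda>h. of_real h ^ m)" and c: "c \<noteq> 0"
  shows "(\<lambda>h. F (c * h)) \<in> o[at 0](\<lambda>h. of_real h ^ m)"
  unfolding smallo_power_at_0_eps_delta
proof (intro allI impI)
  fix e :: real assume e: "e > 0"
  have "e / \<bar>c\<bar> ^ m > 0" using e c by simp
  then obtain d where d: "d > 0"
    "\<And>h. h \<noteq> 0 \<Longrightarrow> \<bar>h\<bar> < d \<Longrightarrow> norm (F h) \<le> e / \<bar>c\<bar> ^ m * \<bar>h\<bar> ^ m"
    using F unfolding smallo_power_at_0_eps_delta by meson
  show "\<exists>d>0. \<forall>h. h \<noteq> 0 \<longrightarrow> \<bar>h\<bar> < d \<longrightarrow> norm (F (c * h)) \<le> e * \<bar>h\<bar> ^ m"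
  proof (intro exI[of _ "d / \<bar>c\<bar>"] conjI allI impI)
    show "d / \<bar>c\<bar> > 0" using d c by simp
    fix h :: real assume h: "h \<noteq> 0" "\<bar>h\<bar> < d / \<bar>c\<bar>"
    have "\<bar>c * h\<bar> < d" using h c by (simp add: field_simps abs_mult)
    then have "norm (F (c * h)) \<le> e / \<bar>c\<bar> ^ m * \<bar>c * h\<bar> ^ m"
      using d(2)[of "c * h"] h c by simp
    also have "\<dots> = e * \<bar>h\<bar> ^ m" using c by (simp add: abs_mult power_mult_distrib)
    finally show "norm (F (c * h)) \<le> e * \<bar>h\<bar> ^ m" .
  qed
qed

subsection \<open>Linear factors\<close>

text \<open>Going from \<open>h\<close> to \<open>h / q\<close> costs a factor of at most
  \<open>\<bar>q\<bar> ^ m\<close>, which the decay of \<open>g\<close> as \<open>o(h ^ m)\<close>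
  absorbs. The errors have one more power of \<open>h\<close>, so they shrink geometrically with
  ratio \<open>1 / \<bar>q\<bar>\<close>.\<close>

lemma smallo_dilation_eigenvalue_small:
  fixes g :: "real \<Rightarrow> complex"
  assumes q: "\<bar>q\<bar> > 1" and z: "norm z \<le> \<bar>q\<bar> ^ m"
    and g: "g \<in> o[at 0](\<lambda>h. of_real h ^ m)"
    and e: "(\<lambda>h. g (q * h) - z * g h) \<in> o[at 0](\<lambda>h. of_real h ^ Suc m)"
  shows "g \<in> o[at 0](\<lambda>h. of_real h ^ Suc m)"
  unfolding smallo_power_at_0_eps_delta
proof (intro allI impI)
  fix \<epsilon> :: real assume eps: "\<epsilon> > 0"
  define Q where "Q = \<bar>q\<bar>"
  have Q: "Q > 1" and q0: "q \<noteq> 0" using q by (auto simp: Q_def)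
  \<comment> \<open>The factor \<open>Q - 1\<close> keeps the error constant at
    \<open>\<epsilon>\<close> for every number of iterations: the induction closes because
    \<open>Q ^ m + (Q - 1) \<le> Q ^ Suc m\<close>.\<close>
  have "\<epsilon> * (Q - 1) > 0" using eps Q by simp
  then obtain d where d: "d > 0" and err:
    "\<And>h. h \<noteq> 0 \<Longrightarrow> \<bar>h\<bar> < d \<Longrightarrow> norm (g (q * h) - z * g h) \<le> \<epsilon> * (Q - 1) * \<bar>h\<bar> ^ Suc m"
    using e unfolding smallo_power_at_0_eps_delta by meson
  have contr: "\<bar>h\<bar> / Q ^ N < d'" if "\<bar>h\<bar> < d'" for h d' :: real and N
  proof -
    have "\<bar>h\<bar> / Q ^ N \<le> \<bar>h\<bar> / 1" using Q by (intro divide_left_mono) auto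
    then show ?thesis using that by simp
  qed
  have step: "norm (g h) \<le> Q ^ m * norm (g (h / q)) + \<epsilon> * (Q - 1) * (\<bar>h\<bar> / Q) ^ Suc m"
    if h: "h \<noteq> 0" "\<bar>h\<bar> < d" for h
  proof -
    have "norm (g (q * (h / q)) - z * g (h / q)) \<le> \<epsilon> * (Q - 1) * \<bar>h / q\<bar> ^ Suc m"
      using err[of "h / q"] h q0 contr[of h d 1] by (simp add: Q_def)
    then have "norm (g h - z * g (h / q)) \<le> \<epsilon> * (Q - 1) * (\<bar>h\<bar> / Q) ^ Suc m"
      using q0 by (simp add: Q_def)
    moreover have "norm (g h) \<le> norm (z * g (h / q)) + norm (g h - z * g (h / q))"
      by (metis add.commute diff_add_cancel norm_triangle_ineq)
    moreover have "norm (z * g (h / q)) \<le> Q ^ m * norm (g (h / q))"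
      using z by (simp add: norm_mult Q_def mult_right_mono)
    ultimately show ?thesis by linarith
  qed
  have iter: "norm (g h) \<le> Q ^ (m * N) * norm (g (h / q ^ N)) + \<epsilon> * \<bar>h\<bar> ^ Suc m"
    if "h \<noteq> 0" "\<bar>h\<bar> < d" for h N
    using that
  proof (induction N arbitrary: h)
    case 0
    then show ?case using eps by simp
  next
    case (Suc N)
    have "\<bar>h / q\<bar> < d" using contr[of h d 1] Suc.prems by (simp add: Q_def)
    then have IH: "norm (g (h / q)) \<le>
        Q ^ (m * N) * norm (g (h / q / q ^ N)) + \<epsilon> * (\<bar>h\<bar> / Q) ^ Suc m"
      using Suc.IH[of "h / q"] Suc.prems q0 by (simp add: Q_def)
    have hq: "h / q / q ^ N = h / q ^ Suc N" by simp
    have "norm (g h) \<le> Q ^ m * norm (g (h / q)) + \<epsilon> * (Q - 1) * (\<bar>h\<bar> / Q) ^ Suc m"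
      using step Suc.prems by blast
    also have "\<dots> \<le> Q ^ m * (Q ^ (m * N) * norm (g (h / q / q ^ N)) + \<epsilon> * (\<bar>h\<bar> / Q) ^ Suc m)
        + \<epsilon> * (Q - 1) * (\<bar>h\<bar> / Q) ^ Suc m"
      using IH Q by (intro add_right_mono mult_left_mono) auto
    also have "\<dots> = Q ^ (m * Suc N) * norm (g (h / q ^ Suc N))
        + \<epsilon> * ((Q ^ m + (Q - 1)) * (\<bar>h\<bar> / Q) ^ Suc m)"
      unfolding hq by (simp add: algebra_simps power_add del: power_Suc)
    also have "(Q ^ m + (Q - 1)) * (\<bar>h\<bar> / Q) ^ Suc m \<le> (Q ^ Suc m) * (\<bar>h\<bar> / Q) ^ Suc m"
    proof (rule mult_right_mono)
      have "(Q - 1) * 1 \<le> (Q - 1) * Q ^ m" using Q by (intro mult_left_mono) auto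
      then show "Q ^ m + (Q - 1) \<le> Q ^ Suc m" by (simp add: algebra_simps)
    qed (use Q in simp)
    also have "\<dots> = \<bar>h\<bar> ^ Suc m" using Q by (simp add: power_divide)
    finally show ?case using eps by simp
  qed
  show "\<exists>d>0. \<forall>h. h \<noteq> 0 \<longrightarrow> \<bar>h\<bar> < d \<longrightarrow> norm (g h) \<le> \<epsilon> * \<bar>h\<bar> ^ Suc m"
  proof (intro exI[of _ d] conjI allI impI d)
    fix h :: real assume h: "h \<noteq> 0" "\<bar>h\<bar> < d"
    show "norm (g h) \<le> \<epsilon> * \<bar>h\<bar> ^ Suc m"
    \<comment> \<open>Here \<open>h\<close> is fixed and \<open>N\<close> grows. The tolerance
      \<open>\<eta> / \<bar>h\<bar> ^ m\<close> at the point \<open>h / q ^ N\<close> exactly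
      offsets the factor \<open>Q ^ (m * N)\<close>; \<open>d\<close> does not depend on
      \<open>\<eta>\<close>.\<close>
    proof (rule field_le_epsilon)
      fix \<eta> :: real assume eta: "\<eta> > 0"
      have "\<eta> / \<bar>h\<bar> ^ m > 0" using eta h by simp
      then obtain d' where d': "d' > 0"
        "\<And>x. x \<noteq> 0 \<Longrightarrow> \<bar>x\<bar> < d' \<Longrightarrow> norm (g x) \<le> \<eta> / \<bar>h\<bar> ^ m * \<bar>x\<bar> ^ m"
        using g unfolding smallo_power_at_0_eps_delta by meson
      obtain N where "\<bar>h\<bar> / d' < Q ^ N" using real_arch_pow[OF Q] by blast
      then have "\<bar>h / q ^ N\<bar> < d'" using d'(1) Q by (simp add: field_simps power_abs Q_def)
      then have "norm (g (h / q ^ N)) \<le> \<eta> / \<bar>h\<bar> ^ m * \<bar>h / q ^ N\<bar> ^ m"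
        using d'(2)[of "h / q ^ N"] h q0 by simp
      also have "\<dots> = \<eta> / Q ^ (m * N)"
        using h by (simp add: power_divide power_abs Q_def power_mult[symmetric] mult.commute)
      finally have "Q ^ (m * N) * norm (g (h / q ^ N)) \<le> \<eta>"
        using Q by (simp add: field_simps)
      then show "norm (g h) \<le> \<epsilon> * \<bar>h\<bar> ^ Suc m + \<eta>" using iter[OF h, of N] by linarith
    qed
  qed
qed

text \<open>Solving for \<open>g h\<close> gains a factor \<open>1 / norm z\<close> per step, but
  the points move away from 0 and must stop inside a fixed ball. There \<open>g\<close> is bounded,
  and after about \<open>N\<close> steps \<open>norm z ^ N\<close> outgrows
  \<open>\<bar>q\<bar> ^ (n * N)\<close>, which is comparable to
  \<open>1 / \<bar>h\<bar> ^ n\<close>.\<close>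

lemma smallo_dilation_eigenvalue_large:
  fixes g :: "real \<Rightarrow> complex"
  assumes q: "\<bar>q\<bar> > 1" and z: "norm z > \<bar>q\<bar> ^ n"
    and g: "g \<in> o[at 0](\<lambda>h. of_real h ^ m)"
    and e: "(\<lambda>h. g (q * h) - z * g h) \<in> o[at 0](\<lambda>h. of_real h ^ n)"
  shows "g \<in> o[at 0](\<lambda>h. of_real h ^ n)"
  unfolding smallo_power_at_0_eps_delta
proof (intro allI impI)
  fix \<epsilon>' :: real assume eps': "\<epsilon>' > 0"
  \<comment> \<open>One half bounds the accumulated errors, the other the value of \<open>g\<close>
    where the iteration stops.\<close>
  define \<epsilon> where "\<epsilon> = \<epsilon>' / 2"
  have eps: "\<epsilon> > 0" using eps' by (simp add: \<epsilon>_def)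
  define Q Z where "Q = \<bar>q\<bar>" and "Z = norm z"
  have Q: "Q > 1" and q0: "q \<noteq> 0" and ZQ: "Z > Q ^ n" using q z by (auto simp: Q_def Z_def)
  have Z: "Z > 0" using ZQ Q by (meson less_trans zero_less_one zero_less_power)
  \<comment> \<open>One step turns the old error coefficient into a multiple of
    \<open>Q ^ n\<close>; adding \<open>Z - Q ^ n\<close> gives exactly \<open>Z\<close>, so the
    bound in \<open>iter\<close> reproduces itself.\<close>
  have "\<epsilon> * (Z - Q ^ n) > 0" using eps ZQ by simp
  then obtain d1 where d1: "d1 > 0" and err1:
    "\<And>h. h \<noteq> 0 \<Longrightarrow> \<bar>h\<bar> < d1 \<Longrightarrow> norm (g (q * h) - z * g h) \<le> \<epsilon> * (Z - Q ^ n) * \<bar>h\<bar> ^ n"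
    using e unfolding smallo_power_at_0_eps_delta by meson
  obtain d2 where d2: "d2 > 0" and gb2: "\<And>h. h \<noteq> 0 \<Longrightarrow> \<bar>h\<bar> < d2 \<Longrightarrow> norm (g h) \<le> 1 * \<bar>h\<bar> ^ m"
    using g zero_less_one unfolding smallo_power_at_0_eps_delta by meson
  define d where "d = min d1 d2"
  have d: "d > 0" using d1 d2 by (simp add: d_def)
  have step: "Z * norm (g h) \<le> norm (g (q * h)) + \<epsilon> * (Z - Q ^ n) * \<bar>h\<bar> ^ n"
    if h: "h \<noteq> 0" "\<bar>h\<bar> < d" for h
  proof -
    have "norm (z * g h) \<le> norm (g (q * h)) + norm (g (q * h) - z * g h)"
      by (metis norm_minus_commute norm_triangle_sub)
    then show ?thesis using err1[of h] h by (simp add: d_def norm_mult Z_def)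
  qed
  have iter: "Z ^ N * norm (g h) \<le> norm (g (q ^ N * h)) + Z ^ N * \<epsilon> * \<bar>h\<bar> ^ n"
    if "h \<noteq> 0" "Q ^ N * \<bar>h\<bar> < d" for h N
    using that
  proof (induction N arbitrary: h)
    case 0
    then show ?case using eps by simp
  next
    case (Suc N)
    have "1 * \<bar>h\<bar> \<le> Q ^ Suc N * \<bar>h\<bar>" using Q by (intro mult_right_mono one_le_power) auto
    then have hd: "\<bar>h\<bar> < d" using Suc.prems by linarith
    have "Q ^ N * \<bar>q * h\<bar> < d" using Suc.prems by (simp add: abs_mult Q_def mult_ac)
    then have IH: "Z ^ N * norm (g (q * h)) \<le>
        norm (g (q ^ N * (q * h))) + Z ^ N * \<epsilon> * (Q * \<bar>h\<bar>) ^ n"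
      using Suc.IH[of "q * h"] Suc.prems q0 by (simp add: abs_mult Q_def)
    have "Z ^ Suc N * norm (g h) = Z ^ N * (Z * norm (g h))" by simp
    also have "\<dots> \<le> Z ^ N * (norm (g (q * h)) + \<epsilon> * (Z - Q ^ n) * \<bar>h\<bar> ^ n)"
      using step[of h] Suc.prems hd Z by (intro mult_left_mono) auto
    also have "\<dots> \<le> norm (g (q ^ N * (q * h))) + Z ^ N * \<epsilon> * (Q * \<bar>h\<bar>) ^ n
        + Z ^ N * (\<epsilon> * (Z - Q ^ n) * \<bar>h\<bar> ^ n)"
      using IH by (simp add: distrib_left)
    also have "\<dots> = norm (g (q ^ Suc N * h)) + Z ^ Suc N * \<epsilon> * \<bar>h\<bar> ^ n"
      by (simp add: algebra_simps power_mult_distrib)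
    finally show ?case .
  qed
  \<comment> \<open>\<open>C\<close> collects the constants of the stopping point:
    \<open>d ^ m\<close> bounds \<open>g\<close> there, and \<open>(Q / d) ^ n\<close> comes from
    \<open>\<bar>h\<bar>\<close> being at least \<open>d / Q ^ Suc N\<close>.\<close>
  define C where "C = d ^ m * (Q / d) ^ n"
  define l where "l = Q ^ n / Z"
  have l: "0 < l" "l < 1" using ZQ Z Q by (auto simp: l_def)
  have C: "C > 0" using d Q by (simp add: C_def)
  obtain N0 where "l ^ N0 < \<epsilon> / C" using real_arch_pow_inv[of "\<epsilon> / C" l] eps C l by auto
  then have N0: "l ^ N0 * C < \<epsilon>" using C by (simp add: field_simps)
  show "\<exists>d>0. \<forall>h. h \<noteq> 0 \<longrightarrow> \<bar>h\<bar> < d \<longrightarrow> norm (g h) \<le> \<epsilon>' * \<bar>h\<bar> ^ n"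
  \<comment> \<open>So small a radius forces more than \<open>N0\<close> steps to leave the ball,
    hence \<open>l ^ N * C < \<epsilon>\<close> at the stopping index.\<close>
  proof (intro exI[of _ "d / Q ^ N0"] conjI allI impI)
    show "d / Q ^ N0 > 0" using d Q by simp
    fix h :: real assume h: "h \<noteq> 0" "\<bar>h\<bar> < d / Q ^ N0"
    define P where "P N \<longleftrightarrow> d \<le> Q ^ N * \<bar>h\<bar>" for N
    obtain N1 where "d / \<bar>h\<bar> < Q ^ N1" using real_arch_pow[OF Q] by blast
    then have P1: "P N1" using h by (simp add: P_def field_simps)
    have nP: "\<not> P N" if "N \<le> N0" for N
    proof -
      have "Q ^ N * \<bar>h\<bar> \<le> Q ^ N0 * \<bar>h\<bar>"
        using Q that by (intro mult_right_mono power_increasing) auto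
      also have "\<dots> < d" using h Q by (simp add: field_simps)
      finally show ?thesis by (simp add: P_def)
    qed
    \<comment> \<open>The predecessor \<open>N\<close> of the first exit index is the last one with
      \<open>q ^ N * h\<close> in the ball; minimality bounds that point from below by
      \<open>d / Q\<close>.\<close>
    define M where "M = (LEAST N. P N)"
    have PM: "P M" unfolding M_def using P1 by (rule LeastI)
    then have "M > N0" using nP[of M] by linarith
    then obtain N where M: "M = Suc N" and N: "N \<ge> N0" by (cases M) auto
    have "\<not> P N" using not_less_Least[of N P] M by (simp add: M_def)
    then have hN: "Q ^ N * \<bar>h\<bar> < d" by (simp add: P_def)
    have lo: "1 \<le> Q ^ N * (\<bar>h\<bar> * (Q / d))"
      using PM d by (simp add: M P_def field_simps)
    have "norm (g (q ^ N * h)) \<le> 1 * \<bar>q ^ N * h\<bar> ^ m"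
      using gb2[of "q ^ N * h"] h q0 hN by (simp add: d_def abs_mult power_abs Q_def)
    also have "\<dots> = (Q ^ N * \<bar>h\<bar>) ^ m" by (simp add: abs_mult power_abs Q_def)
    also have "\<dots> \<le> d ^ m" using hN Q by (intro power_mono) auto
    \<comment> \<open>The inserted factor is at least 1 by \<open>lo\<close>; it trades the constant
      bound for one containing \<open>\<bar>h\<bar> ^ n\<close>.\<close>
    also have "\<dots> \<le> d ^ m * (Q ^ N * (\<bar>h\<bar> * (Q / d))) ^ n"
      using d lo mult_left_mono[of 1 "(Q ^ N * (\<bar>h\<bar> * (Q / d))) ^ n" "d ^ m"] by simp
    also have "\<dots> = (Q ^ n) ^ N * C * \<bar>h\<bar> ^ n"
      by (simp only: C_def power_mult_distrib power_mult[symmetric] mult_ac)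
    also have "\<dots> = Z ^ N * (l ^ N * C) * \<bar>h\<bar> ^ n"
      using Z by (simp add: l_def power_divide)
    also have "\<dots> \<le> Z ^ N * \<epsilon> * \<bar>h\<bar> ^ n"
    proof (intro mult_right_mono mult_left_mono)
      have "l ^ N * C \<le> l ^ N0 * C"
        using l N C by (intro mult_right_mono power_decreasing) auto
      then show "l ^ N * C \<le> \<epsilon>" using N0 by linarith
    qed (use Z in auto)
    finally have "Z ^ N * norm (g h) \<le> Z ^ N * (\<epsilon>' * \<bar>h\<bar> ^ n)"
      using iter[OF h(1) hN] by (simp add: \<epsilon>_def field_simps)
    then show "norm (g h) \<le> \<epsilon>' * \<bar>h\<bar> ^ n" using Z by simp
  qed
qed

text \<open>For \<open>\<bar>q\<bar> > 1\<close> the complement of the annulus is the union of the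
  two ranges above. For \<open>\<bar>q\<bar> < 1\<close>, substituting \<open>h / q\<close> and
  dividing by \<open>- z\<close> gives the same relation for \<open>1 / q\<close> and
  \<open>1 / z\<close>, and inversion maps the complement to those ranges. If \<open>z = 0\<close>,
  the rescaled error is \<open>g\<close> itself.\<close>

lemma smallo_dilation_linear_factor:
  fixes g :: "real \<Rightarrow> complex"
  assumes q: "q \<notin> {0, 1, -1}" and z: "z \<notin> annulus q (Suc m)"
    and g: "g \<in> o[at 0](\<lambda>h. of_real h ^ m)"
    and e: "(\<lambda>h. g (q * h) - z * g h) \<in> o[at 0](\<lambda>h. of_real h ^ Suc m)"
  shows "g \<in> o[at 0](\<lambda>h. of_real h ^ Suc m)"
proof (cases "\<bar>q\<bar> > 1")
  case True
  then have "norm z \<le> \<bar>q\<bar> ^ m \<or> norm z > \<bar>q\<bar> ^ Suc m"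
    using z by (auto simp: annulus_def)
  then show ?thesis
    using smallo_dilation_eigenvalue_small[OF True _ g e]
      smallo_dilation_eigenvalue_large[OF True _ g e] by blast
next
  case False
  then have q1: "\<bar>q\<bar> < 1" and q0: "q \<noteq> 0" using q by auto
  have Q: "\<bar>1 / q\<bar> > 1" using q1 q0 by (simp add: field_simps)
  have e': "(\<lambda>h. g h - z * g (1 / q * h)) \<in> o[at 0](\<lambda>h. of_real h ^ Suc m)"
    using smallo_power_at_0_rescale[OF e, of "1 / q"] q0 by simp
  show ?thesis
  proof (cases "z = 0")
    case True
    then show ?thesis using e' by simp
  next
    case z0: False
    have "(\<lambda>h. (- 1 / z) * (g h - z * g (1 / q * h))) \<in> o[at 0](\<lambda>h. of_real h ^ Suc m)"
      using e' z0 by (subst landau_o.small.cmult_in_iff) auto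
    also have "(\<lambda>h. (- 1 / z) * (g h - z * g (1 / q * h))) = (\<lambda>h. g (1 / q * h) - 1 / z * g h)"
      using z0 by (simp add: fun_eq_iff field_simps)
    finally have E: "(\<lambda>h. g (1 / q * h) - 1 / z * g h) \<in> o[at 0](\<lambda>h. of_real h ^ Suc m)" .
    have "norm z < \<bar>q\<bar> ^ Suc m \<or> norm z \<ge> \<bar>q\<bar> ^ m"
      using z False by (auto simp: annulus_def)
    then have "norm (1 / z) > \<bar>1 / q\<bar> ^ Suc m \<or> norm (1 / z) \<le> \<bar>1 / q\<bar> ^ m"
    proof
      assume "norm z < \<bar>q\<bar> ^ Suc m"
      then have "1 / \<bar>q\<bar> ^ Suc m < 1 / norm z"
        using z0 by (intro divide_strict_left_mono) (auto simp: q0)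
      then show ?thesis by (simp add: norm_divide power_divide)
    next
      assume "norm z \<ge> \<bar>q\<bar> ^ m"
      then have "1 / norm z \<le> 1 / \<bar>q\<bar> ^ m"
        using z0 q0 by (intro divide_left_mono) auto
      then show ?thesis by (simp add: norm_divide power_divide)
    qed
    then show ?thesis
      using smallo_dilation_eigenvalue_small[OF Q _ g E]
        smallo_dilation_eigenvalue_large[OF Q _ g E] by blast
  qed
qed

subsection \<open>Polynomials in the dilation operator\<close>

text \<open>This is \<open>p(T)\<close>. Leaving out the term with \<open>f 0\<close> makes products
  of polynomials correspond to compositions.\<close>

definition dilation_poly :: "real \<Rightarrow> complex poly \<Rightarrow> (real \<Rightarrow> complex) \<Rightarrow> real \<Rightarrow> complex" where
  "dilation_poly q p f h = (\<Sum>k\<le>degree p. coeff p k * f (q ^ k * h))"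

lemma diff_op_eq_dilation_poly:
  "diff_op q p f = (\<lambda>h. - poly p 1 * f 0 + dilation_poly q p f h)"
  by (simp add: diff_op_def dilation_poly_def)

text \<open>A common upper limit allows polynomials of different degrees to be compared term by
  term.\<close>

lemma dilation_poly_altdef:
  assumes "degree p \<le> N"
  shows "dilation_poly q p f h = (\<Sum>k\<le>N. coeff p k * f (q ^ k * h))"
  unfolding dilation_poly_def
  using assms by (intro sum.mono_neutral_left) (auto simp: coeff_eq_0)

lemma dilation_poly_linear_mult:
  "dilation_poly q ([:- z, 1:] * r) f h =
    dilation_poly q r f (q * h) - z * dilation_poly q r f h"
proof -
  have eq: "[:- z, 1:] * r = pCons 0 r - smult z r" by simp
  let ?N = "Suc (degree r)"
  have deg: "degree ([:- z, 1:] * r) \<le> ?N"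
    using degree_mult_le[of "[:- z, 1:]" r] by simp
  have "dilation_poly q ([:- z, 1:] * r) f h =
      (\<Sum>k\<le>?N. (coeff (pCons 0 r) k - z * coeff r k) * f (q ^ k * h))"
    unfolding dilation_poly_altdef[OF deg] unfolding eq by simp
  also have "\<dots> = (\<Sum>k\<le>?N. coeff (pCons 0 r) k * f (q ^ k * h))
      - z * (\<Sum>k\<le>?N. coeff r k * f (q ^ k * h))"
    by (simp add: left_diff_distrib sum_subtractf sum_distrib_left mult.assoc del: sum.atMost_Suc)
  also have "(\<Sum>k\<le>?N. coeff (pCons 0 r) k * f (q ^ k * h)) = dilation_poly q r f (q * h)"
    \<comment> \<open>The term for \<open>k = 0\<close> has coefficient 0; the index shift moves one
      factor \<open>q\<close> into the argument.\<close>
    unfolding dilation_poly_def by (subst sum.atMost_Suc_shift) (simp add: mult_ac)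
  also have "(\<Sum>k\<le>?N. coeff r k * f (q ^ k * h)) = dilation_poly q r f h"
    by (rule dilation_poly_altdef[symmetric]) simp
  finally show ?thesis .
qed

lemma smallo_dilation_poly:
  assumes "f \<in> o[at 0](\<lambda>h. of_real h ^ m)" and "q \<noteq> 0"
  shows "dilation_poly q p f \<in> o[at 0](\<lambda>h. of_real h ^ m)"
  unfolding dilation_poly_def[abs_def]
  using assms by (intro big_sum_in_smallo landau_o.small.cmult smallo_power_at_0_rescale) auto

text \<open>Induction on the degree: with \<open>p = (x - z) * r\<close>, the outer factor
  \<open>T - z\<close> is cancelled first. This is possible because \<open>r(T) f\<close> is again
  \<open>o(h ^ m)\<close>. Roots of \<open>r\<close> are roots of \<open>p\<close>, so the
  hypothesis passes on.\<close>

lemma smallo_dilation_poly_cancel: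
  assumes q: "q \<notin> {0, 1, -1}" and f: "f \<in> o[at 0](\<lambda>h. of_real h ^ m)"
  shows "\<lbrakk>p \<noteq> 0; \<And>z. poly p z = 0 \<Longrightarrow> z \<notin> annulus q (Suc m);
    dilation_poly q p f \<in> o[at 0](\<lambda>h. of_real h ^ Suc m)\<rbrakk>
    \<Longrightarrow> f \<in> o[at 0](\<lambda>h. of_real h ^ Suc m)"
proof (induction "degree p" arbitrary: p)
  case 0
  then obtain c where c: "p = [:c:]" by (metis degree_0_id)
  then have "(\<lambda>h. c * f h) \<in> o[at 0](\<lambda>h. of_real h ^ Suc m)" "c \<noteq> 0"
    using 0 by (auto simp: dilation_poly_def[abs_def])
  then show ?case by (simp add: landau_o.small.cmult_in_iff)
next
  case (Suc d)
  obtain z where z: "poly p z = 0"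
    using fundamental_theorem_of_algebra_alt[of p] Suc.hyps(2) by fastforce
  then obtain r where r: "p = [:- z, 1:] * r" by (metis dvdE poly_eq_0_iff_dvd)
  have r0: "r \<noteq> 0" using Suc.prems r by auto
  have "degree p = Suc (degree r)" unfolding r by (subst degree_mult_eq) (use r0 in auto)
  then have deg: "d = degree r" using Suc.hyps by simp
  have "(\<lambda>h. dilation_poly q r f (q * h) - z * dilation_poly q r f h)
      \<in> o[at 0](\<lambda>h. of_real h ^ Suc m)"
    using Suc.prems(3) unfolding r dilation_poly_linear_mult[abs_def] .
  then have "dilation_poly q r f \<in> o[at 0](\<lambda>h. of_real h ^ Suc m)"
    using smallo_dilation_linear_factor[OF q] Suc.prems(2)[OF z] smallo_dilation_poly[OF f] q
    by blast
  then show ?case using Suc.hyps(1)[OF deg r0] Suc.prems(2) by (simp add: r)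
qed

lemma MZ_property_if_no_root:
  assumes q: "q \<notin> {0, 1, -1}" and p: "p \<noteq> 0"
    and roots: "\<And>z. poly p z = 0 \<Longrightarrow> z \<notin> annulus q (Suc m)"
  shows "MZ_property (Suc m) (diff_op q p)"
  unfolding MZ_property_def
proof (intro allI impI)
  fix f :: "real \<Rightarrow> complex"
  assume "f \<in> o[at 0](\<lambda>h. of_real h ^ (Suc m - 1))"
    and D: "diff_op q p f \<in> o[at 0](\<lambda>h. of_real h ^ Suc m)"
  then have f: "f \<in> o[at 0](\<lambda>h. of_real h ^ m)" by simp
  let ?c = "poly p 1 * f 0"
  have pow: "(\<lambda>h::real. (of_real h :: complex) ^ k) \<in> O[at 0](\<lambda>_. 1)" for k
  proof -
    have "((\<lambda>h::real. (of_real h :: complex) ^ k) \<longlongrightarrow> of_real 0 ^ k) (at 0)"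
      by (intro tendsto_intros)
    then show ?thesis by (intro bigoI_tendsto) auto
  qed
  \<comment> \<open>Two functions tending to 0 differ by the constant \<open>?c\<close>, so it
    vanishes. This is a statement about the product; \<open>f 0\<close> itself may be nonzero when
    \<open>poly p 1 = 0\<close>.\<close>
  have "dilation_poly q p f \<in> o[at 0](\<lambda>_. 1)"
    using landau_o.small_big_trans[OF smallo_dilation_poly[OF f] pow] q by simp
  moreover have "diff_op q p f \<in> o[at 0](\<lambda>_. 1)"
    using landau_o.small_big_trans[OF D pow] .
  ultimately have "(\<lambda>h. dilation_poly q p f h - diff_op q p f h) \<in> o[at 0](\<lambda>_. 1)"
    by (rule sum_in_smallo)
  then have "(\<lambda>_. ?c) \<in> o[at (0::real)](\<lambda>_. 1)"
    by (simp add: diff_op_eq_dilation_poly)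
  then have "((\<lambda>_. ?c) \<longlongrightarrow> 0) (at (0::real))" using smalloD_tendsto by fastforce
  then have "?c = 0" by (simp add: tendsto_const_iff)
  then have "dilation_poly q p f = diff_op q p f"
    by (auto simp: diff_op_eq_dilation_poly fun_eq_iff)
  then show "f \<in> o[at 0](\<lambda>h. of_real h ^ Suc m)"
    using smallo_dilation_poly_cancel[OF q f p roots] D by simp
qed

subsection \<open>Eigenfunctions\<close>

text \<open>The quotient is the exponent \<open>t\<close> with
  \<open>norm z = \<bar>q\<bar> powr t\<close>. For \<open>\<bar>q\<bar> < 1\<close> the negative
  \<open>ln \<bar>q\<bar>\<close> reverses the inequalities, so both cases of the annulus give the
  same half-open interval.\<close>

lemma log_norm_in_annulus:
  assumes q: "q \<notin> {0, 1, -1}" and z: "z \<in> annulus q (Suc m)"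
  shows "real m < ln (norm z) / ln \<bar>q\<bar>" and "ln (norm z) / ln \<bar>q\<bar> \<le> real (Suc m)"
    and "z \<noteq> 0"
proof -
  have Q: "\<bar>q\<bar> > 0" "\<bar>q\<bar> \<noteq> 1" using q by auto
  show z0: "z \<noteq> 0"
    using z Q by (auto simp: annulus_def power_le_zero_eq simp del: power_Suc split: if_splits)
  have lnp: "ln (\<bar>q\<bar> ^ k) = real k * ln \<bar>q\<bar>" for k using Q by (simp add: ln_realpow)
  show "real m < ln (norm z) / ln \<bar>q\<bar>"
  proof (cases "\<bar>q\<bar> > 1")
    case True
    then have "ln (\<bar>q\<bar> ^ m) < ln (norm z)"
      using z z0 Q by (subst ln_less_cancel_iff) (auto simp: annulus_def)
    then show ?thesis using True unfolding lnp by (simp add: field_simps)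
  next
    case False
    then have "ln (norm z) < ln (\<bar>q\<bar> ^ m)"
      using z z0 Q by (subst ln_less_cancel_iff) (auto simp: annulus_def)
    moreover have "ln \<bar>q\<bar> < 0" using False Q by simp
    ultimately show ?thesis unfolding lnp by (simp add: field_simps)
  qed
  show "ln (norm z) / ln \<bar>q\<bar> \<le> real (Suc m)"
  proof (cases "\<bar>q\<bar> > 1")
    case True
    then have "ln (norm z) \<le> ln (\<bar>q\<bar> ^ Suc m)"
      using z z0 Q by (subst ln_le_cancel_iff) (auto simp: annulus_def)
    then show ?thesis using True unfolding lnp by (simp add: field_simps)
  next
    case False
    then have "ln (\<bar>q\<bar> ^ Suc m) \<le> ln (norm z)"
      using z z0 Q by (subst ln_le_cancel_iff) (auto simp: annulus_def)
    moreover have "ln \<bar>q\<bar> < 0" using False Q by simp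
    ultimately show ?thesis unfolding lnp by (simp add: field_simps)
  qed
qed

lemma not_MZ_property_if_root:
  assumes q: "q \<notin> {0, 1, -1}" and z: "z \<in> annulus q (Suc m)" and pz: "poly p z = 0"
  shows "\<not> MZ_property (Suc m) (diff_op q p)"
proof
  assume MZ: "MZ_property (Suc m) (diff_op q p)"
  define t where "t = ln (norm z) / ln \<bar>q\<bar>"
  \<comment> \<open>\<open>s\<close> is a complex logarithm of \<open>z\<close> to base
    \<open>\<bar>q\<bar>\<close>, with real part \<open>t\<close>.\<close>
  define s where "s = Ln z / of_real (ln \<bar>q\<bar>)"
  have t: "real m < t" "t \<le> real (Suc m)" and z0: "z \<noteq> 0"
    using log_norm_in_annulus[OF q z] by (auto simp: t_def)
  have Q: "\<bar>q\<bar> > 0" "\<bar>q\<bar> \<noteq> 1" using q by auto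
  then have lq: "ln \<bar>q\<bar> \<noteq> 0" by simp
  \<comment> \<open>Using \<open>\<bar>h\<bar>\<close> covers negative \<open>h\<close> and negative
    \<open>q\<close>. The value 0 at 0 removes the term \<open>poly p 1 * f 0\<close> and keeps the
    eigenvalue relation valid there.\<close>
  define f :: "real \<Rightarrow> complex"
    where "f h = (if h = 0 then 0 else exp (of_real (ln \<bar>h\<bar>) * s))" for h
  have nf: "norm (f h) = \<bar>h\<bar> powr t" if "h \<noteq> 0" for h
    using that z0 by (simp add: f_def s_def t_def norm_exp_eq_Re powr_def mult.commute)
  have f1: "f (q * h) = z * f h" for h
  proof (cases "h = 0")
    case False
    have "ln \<bar>q * h\<bar> = ln \<bar>q\<bar> + ln \<bar>h\<bar>" using False Q by (simp add: abs_mult ln_mult)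
    then have "f (q * h) = exp (of_real (ln \<bar>q\<bar>) * s) * f h"
      using False Q by (simp add: f_def distrib_right exp_add)
    also have "of_real (ln \<bar>q\<bar>) * s = Ln z" using lq by (simp add: s_def)
    finally show ?thesis using z0 by simp
  qed (simp add: f_def)
  have fk: "f (q ^ k * h) = z ^ k * f h" for k h
    by (induction k) (simp_all add: f1 mult.assoc)
  have "diff_op q p f = (\<lambda>h. poly p z * f h)"
    by (simp add: diff_op_def fk f_def[of 0] poly_altdef sum_distrib_right mult.assoc fun_eq_iff)
  then have D: "diff_op q p f \<in> o[at 0](\<lambda>h. of_real h ^ Suc m)"
    by (simp add: pz)
  have "f \<in> o[at 0](\<lambda>h. of_real h ^ m)"
    unfolding smallo_power_at_0_eps_delta
  proof (intro allI impI)
    fix e :: real assume e: "e > 0"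
    show "\<exists>d>0. \<forall>h. h \<noteq> 0 \<longrightarrow> \<bar>h\<bar> < d \<longrightarrow> norm (f h) \<le> e * \<bar>h\<bar> ^ m"
    \<comment> \<open>This radius solves \<open>d powr (t - m) = e\<close>; the exponent is positive
      since \<open>m < t\<close>.\<close>
    proof (intro exI[of _ "e powr (1 / (t - m))"] conjI allI impI)
      show "e powr (1 / (t - m)) > 0" using e by simp
      fix h :: real assume h: "h \<noteq> 0" "\<bar>h\<bar> < e powr (1 / (t - m))"
      have "\<bar>h\<bar> powr (t - m) \<le> (e powr (1 / (t - m))) powr (t - m)"
        using h t by (intro powr_mono2) auto
      also have "\<dots> = e" using e t by (simp add: powr_powr)
      finally have "\<bar>h\<bar> powr (t - m) * \<bar>h\<bar> powr m \<le> e * \<bar>h\<bar> ^ m"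
        using h by (simp add: powr_realpow mult_right_mono)
      then show "norm (f h) \<le> e * \<bar>h\<bar> ^ m"
        using h by (simp add: nf flip: powr_add)
    qed
  qed
  then have "f \<in> o[at 0](\<lambda>h. of_real h ^ Suc m)"
    using MZ D unfolding MZ_property_def by simp
  then obtain d where d: "d > 0"
    "\<And>h. h \<noteq> 0 \<Longrightarrow> \<bar>h\<bar> < d \<Longrightarrow> norm (f h) \<le> 1 / 2 * \<bar>h\<bar> ^ Suc m"
    unfolding smallo_power_at_0_eps_delta by (meson half_gt_zero zero_less_one)
  \<comment> \<open>For \<open>0 < h < 1\<close>, \<open>t \<le> Suc m\<close> gives
    \<open>h ^ Suc m \<le> h powr t\<close>, which contradicts the bound with factor
    \<open>1 / 2\<close>.\<close>
  define h where "h = min d 1 / 2"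
  have h: "0 < h" "h < d" "h < 1" using d by (auto simp: h_def)
  have "h ^ Suc m = h powr real (Suc m)" using h by (simp only: powr_realpow)
  also have "\<dots> \<le> h powr t" using h t by (intro powr_mono') auto
  also have "\<dots> \<le> 1 / 2 * h ^ Suc m" using d(2)[of h] nf[of h] h by simp
  finally show False using h by simp
qed

theorem theorem11:
  fixes q :: real and n :: nat and p :: "complex poly"
  assumes "q \<notin> {0, 1, -1}" and "n \<ge> 1" and "p \<noteq> 0"
  shows "MZ_property n (diff_op q p) \<longleftrightarrow> \<not> (\<exists>z \<in> annulus q n. poly p z = 0)"
proof -
  \<comment> \<open>This turns the truncated \<open>n - 1\<close> of the definitions into
    \<open>m\<close>.\<close>
  obtain m where "n = Suc m" using assms(2) by (cases n) auto
  then show ?thesis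
    using MZ_property_if_no_root[OF assms(1,3)] not_MZ_property_if_root[OF assms(1)] by blast
qed

end
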